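(* Let $x,z$ be formal variables and define rational functions $G_n(w)$ for $n\ge1$ by $G_1(w)=\frac1w$ and, for $n\ge2$, $$G_n(w)=\sum_{k=1}^{n-1}\frac{G_k(w)\,G_{n-k}(w+kz)}{w+(n-1)x}.$$ For integers $1\le k<n$ define $F_{k,n}(w)$ by $F_{1,n}(w)=G_n(w)$ and, for $k\ge2$, $$F_{k,n}(w)=\sum_{i=1}^{n-k-1}\frac{G_{n-k-i}(w+(k+i)z)\,F_{k,k+i}(w)}{w+(n-1)x}+\sum_{i=1}^{k-1}\frac{(w+iz)\,G_i(w+x)\,F_{k-i,n-i}(w+iz)}{w\,(w+(n-1)x)}.$$ Then for each $n\ge3$, $$F_{2,n}(w)=G_n(w)-\frac{G_{n-1}(w+z)}{w(w+x)}.$$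
   Context: All functions are rational functions in $w,x,z$, with $x$ and $z$ treated as constant formal variables and $w$ as the argument. *)

theory Defs
  imports "HOL-Computational_Algebra.Computational_Algebra"
begin

text \<open>
  The rational functions in the indeterminates x, z, w over a field K are the fractions of
  \<open>K[x][z][w]\<close>; the outermost polynomial variable is the argument \<open>w\<close>, and the
  indeterminates \<open>x\<close> and \<open>z\<close> live in the coefficient ring \<open>K[x][z]\<close>.
\<close>

type_synonym 'a ratfun = "'a poly poly poly fract"

definition x_coeff :: "'a::field_char_0 poly poly" where
  "x_coeff = [:[:0, 1:]:]"

definition z_coeff :: "'a::field_char_0 poly poly" where
  "z_coeff = [:0, 1:]"

definition const :: "'b::idom \<Rightarrow> 'b poly fract" where
  "const c = to_fract [:c:]"

definition argw :: "'b::idom poly fract" where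
  "argw = to_fract [:0, 1:]"

abbreviation W :: "'a::field_char_0 ratfun" where "W \<equiv> argw"
abbreviation X :: "'a::field_char_0 ratfun" where "X \<equiv> const x_coeff"
abbreviation Z :: "'a::field_char_0 ratfun" where "Z \<equiv> const z_coeff"

lemma pcompose_shift_eq_0_iff:
  fixes p :: "'b::idom poly"
  shows "pcompose p [:c, 1:] = 0 \<longleftrightarrow> p = 0"
  using pcompose_eq_0[of p "[:c, 1:]"] by auto

text \<open>
  \<open>shift c f\<close> is \<open>f(w + c)\<close>: substitute in numerator and denominator of any
  representation of \<open>f\<close> (see \<open>shift_Fract\<close> for well-definedness).
\<close>

definition shift :: "'b::idom \<Rightarrow> 'b poly fract \<Rightarrow> 'b poly fract" where
  "shift c f = (THE g. \<exists>p q. q \<noteq> 0 \<and> f = Fract p q \<and>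
                         g = Fract (pcompose p [:c, 1:]) (pcompose q [:c, 1:]))"

lemma shift_Fract:
  assumes "q \<noteq> 0"
  shows "shift c (Fract p q) = Fract (pcompose p [:c, 1:]) (pcompose q [:c, 1:])"
  unfolding shift_def
proof (rule the_equality)
  fix g
  assume "\<exists>p' q'. q' \<noteq> 0 \<and> Fract p q = Fract p' q' \<and>
            g = Fract (pcompose p' [:c, 1:]) (pcompose q' [:c, 1:])"
  then obtain p' q' where q': "q' \<noteq> 0" and eq: "Fract p q = Fract p' q'"
    and g: "g = Fract (pcompose p' [:c, 1:]) (pcompose q' [:c, 1:])"
    by blast
  from eq assms q' have "p * q' = p' * q"
    by (simp add: eq_fract)
  then show "g = Fract (pcompose p [:c, 1:]) (pcompose q [:c, 1:])"
    using assms q' by (simp add: g eq_fract pcompose_shift_eq_0_iff flip: pcompose_mult)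
qed (use assms in blast)

lemma shift_argw: "shift c argw = argw + const c"
  by (simp add: argw_def const_def to_fract_def shift_Fract pcompose_pCons pcompose_1)

lemma shift_const: "shift c (const d) = const d"
  by (simp add: const_def to_fract_def shift_Fract pcompose_1)

lemma shift_add: "shift c (f + g) = shift c f + shift c g"
  by (cases f; cases g) (simp add: shift_Fract pcompose_shift_eq_0_iff pcompose_add pcompose_mult)

lemma shift_mult: "shift c (f * g) = shift c f * shift c g"
  by (cases f; cases g) (simp add: shift_Fract pcompose_mult)

text \<open>\<open>G n\<close> is \<open>G\<^sub>n(w)\<close> for \<open>n \<ge> 1\<close>; \<open>G 0\<close> is a dummy value.\<close>

fun G :: "nat \<Rightarrow> 'a::field_char_0 ratfun" where
  "G n =
    (if n = 0 then 0
     else if n = 1 then 1 / W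
     else (\<Sum>k=1..n-1. G k * shift (of_nat k * z_coeff) (G (n - k))
                        / (W + of_nat (n - 1) * X)))"

text \<open>\<open>F k n\<close> is \<open>F\<^sub>k\<^sub>,\<^sub>n(w)\<close> for \<open>1 \<le> k < n\<close>; other values are dummies.\<close>

function F :: "nat \<Rightarrow> nat \<Rightarrow> 'a::field_char_0 ratfun" where
  "F k n =
    (if \<not> (1 \<le> k \<and> k < n) then 0
     else if k = 1 then G n
     else (\<Sum>i=1..n-k-1. shift (of_nat (k + i) * z_coeff) (G (n - k - i)) * F k (k + i)
                          / (W + of_nat (n - 1) * X))
        + (\<Sum>i=1..k-1. (W + of_nat i * Z) * shift x_coeff (G i)
                          * shift (of_nat i * z_coeff) (F (k - i) (n - i))
                          / (W * (W + of_nat (n - 1) * X))))"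
  by pat_completeness auto
termination by (relation "measure snd") auto

declare G.simps [simp del] F.simps [simp del]

end

(*
  Clearing denominators, w + (n-1)x times F_{2,n} is the convolution of F_{2,m} with
  G_{n-m}(w + mz) over 3 <= m < n plus a multiple of G_{n-1}(w + z).  Insert the claimed form of
  F_{2,m}, which vanishes for m = 2, so that the sum may start there.  Both resulting
  convolutions are instances of the recursion for G, at w for the index n and at w + z for the
  index n - 1, and the coefficients of G_{n-1}(w + z) add up to -(w + (n-1)x) / (w (w + x)).
*)
theory Submission
  imports Defs
begin

lemma const_add: "const (a + b) = const a + const b"
  by (simp add: const_def flip: to_fract_add)

lemma const_mult: "const (a * b) = const a * const b"
  by (simp add: const_def flip: to_fract_mult)

lemma const_of_nat: "const (of_nat n) = of_nat n"
  by (induction n) (simp_all add: const_add, simp_all add: const_def pCons_one)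

text \<open>The fraction comes from the polynomial w + c, whose leading coefficient is 1.\<close>

lemma argw_add_const_nonzero: "argw + const c \<noteq> 0"
  by (simp add: argw_def const_def flip: to_fract_add)

lemma W_add_of_nat_X_nonzero: "W + of_nat n * X \<noteq> 0"
  using argw_add_const_nonzero[of "of_nat n * x_coeff"]
  by (simp add: const_mult const_of_nat)

lemma shift_0: "shift c 0 = 0"
  using shift_const[of c 0] by (simp add: const_def)

lemma shift_1: "shift c 1 = 1"
  using shift_const[of c 1] by (simp add: const_def pCons_one)

text \<open>Multiplicativity together with \<open>shift_1\<close> forces this for nonzero f; at f =
  0 both sides are 0, as \<open>inverse 0 = 0\<close>.\<close>

lemma shift_inverse: "shift c (inverse f) = inverse (shift c f)"
proof (cases "f = 0")
  case False
  have "shift c f * shift c (inverse f) = 1"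
    using False by (simp add: shift_1 flip: shift_mult)
  then show ?thesis
    by (metis inverse_unique)
qed (simp add: shift_0)

lemma shift_divide: "shift c (f / g) = shift c f / shift c g"
  by (simp add: divide_inverse shift_mult shift_inverse)

lemma shift_sum: "shift c (\<Sum>i\<in>A. f i) = (\<Sum>i\<in>A. shift c (f i))"
  by (induction A rule: infinite_finite_induct) (simp_all add: shift_0 shift_add)

text \<open>Applied to numerator and denominator, this is associativity of polynomial
  composition.\<close>

lemma shift_shift: "shift a (shift b f) = shift (a + b) f"
proof (cases f)
  case (Fract p q)
  have "pcompose (pcompose r [:b, 1:]) [:a, 1:] = pcompose r [:a + b, 1:]" for r
    by (simp add: pcompose_pCons add.commute flip: pcompose_assoc)
  with Fract show ?thesis
    by (simp add: shift_Fract pcompose_shift_eq_0_iff)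
qed

lemma G_1: "G 1 = 1 / W"
  by (subst G.simps) simp

text \<open>Clearing the denominator, which is independent of k, gives a form of the recursion in
  which sums can be recognised and replaced.\<close>

lemma G_convolution:
  assumes "n \<ge> 2"
  shows "(\<Sum>k=1..n-1. G k * shift (of_nat k * z_coeff) (G (n - k)))
           = (W + of_nat (n - 1) * X) * (G n :: 'a::field_char_0 ratfun)"
proof -
  have "(G n :: 'a ratfun) = (\<Sum>k=1..n-1. G k * shift (of_nat k * z_coeff) (G (n - k)))
                / (W + of_nat (n - 1) * X)"
    using assms by (subst G.simps) (simp add: sum_divide_distrib)
  then show ?thesis
    using W_add_of_nat_X_nonzero[of "n - 1", where ?'a = 'a] by simp
qed

text \<open>This is the recursion for index n - 1 with w replaced by w + z. The extra shift turns kz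
  into (k + 1)z, so the summation index becomes m = k + 1.\<close>

lemma shift_G_convolution:
  assumes "n \<ge> 3"
  shows "(\<Sum>m=2..n-1. shift z_coeff (G (m - 1)) * shift (of_nat m * z_coeff) (G (n - m)))
           = (W + Z + of_nat (n - 2) * X) * shift z_coeff (G (n - 1) :: 'a::field_char_0 ratfun)"
proof -
  have of_nat_shift: "shift c (of_nat k) = of_nat k" for c :: "'b::idom" and k
    using shift_const[of c "of_nat k"] by (simp add: const_of_nat)
  have "(\<Sum>m=2..n-1. shift z_coeff (G (m - 1) :: 'a ratfun)
          * shift (of_nat m * z_coeff) (G (n - m)))
      = (\<Sum>k=1..n-2. shift z_coeff (G k * shift (of_nat k * z_coeff) (G (n - 1 - k))))"
    by (rule sum.reindex_bij_witness[of _ Suc "\<lambda>m. m - 1"])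
       (use assms in \<open>auto simp: shift_mult shift_shift of_nat_diff algebra_simps\<close>)
  also have "n - 2 = n - 1 - 1"
    by simp
  also have "(\<Sum>k=1..n-1-1. shift z_coeff ((G k :: 'a ratfun)
          * shift (of_nat k * z_coeff) (G (n - 1 - k))))
      = shift z_coeff ((W + of_nat (n - 2) * X) * G (n - 1))"
    using G_convolution[of "n - 1", where ?'a = 'a] assms by (simp only: flip: shift_sum) simp
  finally show ?thesis
    by (simp add: shift_mult shift_add shift_argw shift_const of_nat_shift)
qed

text \<open>For k = 2 the second sum of the recursion is the single term i = 1, built from
  \<open>F 1 (n - 1) = G (n - 1)\<close> and G_1(w + x) = 1/(w + x). Setting m = 2 + i in the first
  sum exposes a convolution.\<close>

lemma F_2_recurrence:
  assumes "n \<ge> 3"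
  shows "(W + of_nat (n - 1) * X) * F 2 n
           = (\<Sum>m=3..n-1. shift (of_nat m * z_coeff) (G (n - m)) * F 2 m)
             + (W + Z) * shift z_coeff (G (n - 1) :: 'a::field_char_0 ratfun) / (W * (W + X))"
proof -
  have F1: "(F (Suc 0) (n - 1) :: 'a ratfun) = G (n - 1)"
    using assms by (subst F.simps) simp
  have reindex: "(\<Sum>i=1..n-3. shift (of_nat (2 + i) * z_coeff) (G (n - 2 - i))
          * (F 2 (2 + i) :: 'a ratfun))
      = (\<Sum>m=3..n-1. shift (of_nat m * z_coeff) (G (n - m)) * F 2 m)"
    by (rule sum.reindex_bij_witness[of _ "\<lambda>m. m - 2" "\<lambda>i. 2 + i"])
       (use assms in auto)
  have "(F 2 n :: 'a ratfun)
            = (\<Sum>i=1..n-3. shift (of_nat (2 + i) * z_coeff) (G (n - 2 - i)) * F 2 (2 + i))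
                  / (W + of_nat (n - 1) * X)
              + (W + Z) * shift x_coeff (G 1) * shift z_coeff (G (n - 1))
                  / (W * (W + of_nat (n - 1) * X))"
    using assms F1 by (subst F.simps) (simp add: sum_divide_distrib numeral_3_eq_3)
  also have "shift x_coeff (G 1) = 1 / (W + X :: 'a ratfun)"
    by (simp only: G_1 shift_divide shift_1 shift_argw)
  finally show ?thesis
    unfolding reindex using W_add_of_nat_X_nonzero[of "n - 1", where ?'a = 'a]
    by (simp add: distrib_left[of "W + of_nat (n - Suc 0) * X"])
qed

theorem theorem2p1:
  fixes n :: nat
  assumes "n \<ge> 3"
  shows "(F 2 n :: 'a::field_char_0 ratfun) = G n - shift z_coeff (G (n - 1)) / (W * (W + X))"
  using assms
proof (induction n rule: less_induct)
  case (less n)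
  define D :: "'a ratfun" where "D = W * (W + X)"
  define S :: "nat \<Rightarrow> 'a ratfun" where "S m = shift (of_nat m * z_coeff) (G (n - m))" for m
  define H :: "nat \<Rightarrow> 'a ratfun" where "H m = G m - shift z_coeff (G (m - 1)) / D" for m
  define Q :: "'a ratfun" where "Q = shift z_coeff (G (n - 1))"
  have "(of_nat (n - 1) :: 'a ratfun) = of_nat (n - 2) + 1"
    using less.prems by (simp add: of_nat_diff)
  then have "(W + X) + (W + Z + of_nat (n - 2) * X) - (W + Z)
      = (W + of_nat (n - 1) * X :: 'a ratfun)"
    by (simp add: algebra_simps)
  \<comment> \<open>The three terms on the right arise from the m = 1 term of the convolution for
    \<open>G n\<close>, from the shifted convolution and from the i = 1 term of the recursion for
    \<open>F 2 n\<close>.\<close>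
  then have coeffs: "(W + of_nat (n - 1) * X) * Q / D
      = (W + X) * Q / D + (W + Z + of_nat (n - 2) * X) * Q / D - (W + Z) * Q / D"
    by (simp only: flip: add_divide_distrib diff_divide_distrib distrib_right left_diff_distrib)
  have W: "W \<noteq> (0 :: 'a ratfun)" and WX: "W + X \<noteq> (0 :: 'a ratfun)"
    using W_add_of_nat_X_nonzero[of 0] W_add_of_nat_X_nonzero[of 1] by simp_all
  \<comment> \<open>The recursion for \<open>G 2\<close> has one summand, G_1(w) G_1(w + z), and
    G_1(w) = 1/w. Hence the claimed form \<open>H\<close> vanishes at 2, and a sum from 3 extends to
    one from 2.\<close>
  have "shift z_coeff (G 1) = D * G 2"
    using G_convolution[of 2, where ?'a = 'a] W
    by (simp add: D_def G_1[unfolded One_nat_def] field_simps)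
  then have H2: "H 2 = 0"
    using W WX by (simp add: H_def D_def)
  \<comment> \<open>The induction hypothesis applies to every index here, since 3 \<le> m <
    n.\<close>
  have "(\<Sum>m=3..n-1. S m * F 2 m) = (\<Sum>m=3..n-1. S m * H m)"
    using less by (intro sum.cong) (auto simp: H_def D_def)
  also have "\<dots> = (\<Sum>m=2..n-1. S m * H m)"
    using less.prems H2 by (subst (2) sum.atLeast_Suc_atMost) (simp_all add: numeral_3_eq_3)
  also have "\<dots> = (\<Sum>m=2..n-1. G m * S m)
                  - (\<Sum>m=2..n-1. shift z_coeff (G (m - 1)) * S m) / D"
    by (simp add: H_def algebra_simps sum_subtractf sum_divide_distrib)
  \<comment> \<open>The full convolution starts at m = 1, whose term is G_1(w) G_{n-1}(w + z), that
    is \<open>Q / W\<close>.\<close>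
  also have "(\<Sum>m=2..n-1. G m * S m) = (\<Sum>m=1..n-1. G m * S m) - Q / W"
    using less.prems
    by (subst (2) sum.atLeast_Suc_atMost)
       (simp_all add: Q_def S_def G_1[unfolded One_nat_def] numeral_2_eq_2)
  also have "(\<Sum>m=1..n-1. G m * S m) = (W + of_nat (n - 1) * X) * G n"
    unfolding S_def using less.prems by (intro G_convolution) simp
  also have "(\<Sum>m=2..n-1. shift z_coeff (G (m - 1)) * S m) = (W + Z + of_nat (n - 2) * X) * Q"
    unfolding S_def Q_def using less.prems by (rule shift_G_convolution)
  finally have "(W + of_nat (n - 1) * X) * F 2 n
      = (W + of_nat (n - 1) * X) * G n - Q / W - (W + Z + of_nat (n - 2) * X) * Q / D
        + (W + Z) * Q / D"
    using F_2_recurrence[OF less.prems, where ?'a = 'a] by (simp add: S_def Q_def D_def)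
  also have "Q / W = (W + X) * Q / D"
    using W WX by (simp add: D_def)
  finally have "(W + of_nat (n - 1) * X) * F 2 n
      = (W + of_nat (n - 1) * X) * (G n - Q / D)"
    using coeffs by (simp add: right_diff_distrib)
  then show ?case
    using W_add_of_nat_X_nonzero[of "n - 1", where ?'a = 'a] by (simp add: Q_def D_def)
qed

end
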